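(* Let $\Gamma$ be an infinite discrete group (not necessarily countable), let $k \geq 1$ be an integer, and let $V \subseteq k^\Gamma$ be a nonempty open set. Then there exists $n \in \mathbb{N}$ such that for every finite set $F \subset \Gamma$ with $|F| \geq n$, the set $F \cdot V = \{\sigma \cdot v : \sigma \in F,\ v \in V\}$ traps a point; that is, there exists $x \in k^\Gamma$ such that $\gamma \cdot x \in F \cdot V$ for all $\gamma \in \Gamma$.
   Context: For an integer $k \geq 1$, identify $k$ with the $k$-element set $\{i \in \mathbb{N} : i < k\}$ equipped with the discrete topology. The space $k^\Gamma$ of all functions $\Gamma \to k$ carries the product topology, and $\Gamma$ acts on it by $(\gamma \cdot x)(\delta) := x(\delta\gamma)$ for all $\gamma, \delta \in \Gamma$ and $x \in k^\Gamma$. Given a continuous action of $\Gamma$ on a nonempty compact Hausdorff space $X$, a set $U \subseteq X$ traps a point $x \in X$ if the orbit $\{\gamma \cdot x : \gamma \in \Gamma\}$ of $x$ is contained in $U$. *)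

theory Defs
  imports "HOL-Analysis.Analysis" "HOL-Algebra.Group_Action"
begin

definition shift_space :: "nat \<Rightarrow> ('a, 'b) monoid_scheme \<Rightarrow> ('a \<Rightarrow> nat) topology" where
  "shift_space k G = product_topology (\<lambda>_. discrete_topology {..<k}) (carrier G)"

text \<open>
  Points of \<^term>\<open>shift_space k G\<close> are extensional functions on \<^term>\<open>carrier G\<close>, and the
  bijections making up a \<^const>\<open>group_action\<close> are extensional on the space acted upon;
  the two restrictions in the following definition account for this.
\<close>

definition shift_act :: "nat \<Rightarrow> ('a, 'b) monoid_scheme \<Rightarrow> 'a \<Rightarrow> ('a \<Rightarrow> nat) \<Rightarrow> 'a \<Rightarrow> nat" where
  "shift_act k G \<gamma> =
     (\<lambda>x \<in> topspace (shift_space k G). \<lambda>\<delta> \<in> carrier G. x (\<delta> \<otimes>\<^bsub>G\<^esub> \<gamma>))"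

definition traps ::
  "('a, 'c) monoid_scheme \<Rightarrow> ('a \<Rightarrow> 'b \<Rightarrow> 'b) \<Rightarrow> 'b set \<Rightarrow> 'b \<Rightarrow> bool" where
  "traps G \<phi> U x \<longleftrightarrow> orbit G \<phi> x \<subseteq> U"

definition translates :: "('a \<Rightarrow> 'b \<Rightarrow> 'b) \<Rightarrow> 'a set \<Rightarrow> 'b set \<Rightarrow> 'b set" where
  "translates \<phi> F V = {\<phi> \<sigma> v | \<sigma> v. \<sigma> \<in> F \<and> v \<in> V}"

lemma topspace_shift_space: "topspace (shift_space k G) = carrier G \<rightarrow>\<^sub>E {..<k}"
  by (simp add: shift_space_def)

lemma shift_act_closed:
  assumes "group G" "\<gamma> \<in> carrier G" "x \<in> topspace (shift_space k G)"
  shows "shift_act k G \<gamma> x \<in> topspace (shift_space k G)"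
proof -
  interpret group G by fact
  show ?thesis
    using assms by (auto simp: shift_act_def topspace_shift_space PiE_iff)
qed

lemma shift_act_mult:
  assumes "group G" "\<gamma> \<in> carrier G" "\<gamma>' \<in> carrier G" "x \<in> topspace (shift_space k G)"
  shows "shift_act k G (\<gamma> \<otimes>\<^bsub>G\<^esub> \<gamma>') x = shift_act k G \<gamma> (shift_act k G \<gamma>' x)"
proof -
  interpret group G by fact
  show ?thesis
    using shift_act_closed[OF assms(1,3,4)] assms
    by (auto simp: shift_act_def fun_eq_iff m_assoc)
qed

lemma shift_act_one:
  assumes "group G" "x \<in> topspace (shift_space k G)"
  shows "shift_act k G \<one>\<^bsub>G\<^esub> x = x"
proof -
  interpret group G by fact
  show ?thesis
    using assms
    by (auto simp: shift_act_def topspace_shift_space PiE_iff extensional_def fun_eq_iff)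
qed

lemma shift_act_group_action:
  assumes "group G"
  shows "group_action G (topspace (shift_space k G)) (shift_act k G)"
proof -
  interpret group G by fact
  let ?E = "topspace (shift_space k G)"
  have bij: "shift_act k G \<gamma> \<in> Bij ?E" if g: "\<gamma> \<in> carrier G" for \<gamma>
  proof -
    have "bij_betw (shift_act k G \<gamma>) ?E ?E"
    proof (rule bij_betw_byWitness[where f' = "shift_act k G (inv\<^bsub>G\<^esub> \<gamma>)"])
      show "\<forall>a\<in>?E. shift_act k G (inv\<^bsub>G\<^esub> \<gamma>) (shift_act k G \<gamma> a) = a"
        using g assms by (simp flip: shift_act_mult add: shift_act_one)
      show "\<forall>a\<in>?E. shift_act k G \<gamma> (shift_act k G (inv\<^bsub>G\<^esub> \<gamma>) a) = a"
        using g assms by (simp flip: shift_act_mult add: shift_act_one)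
    qed (use g assms in \<open>auto intro: shift_act_closed\<close>)
    moreover have "shift_act k G \<gamma> \<in> extensional ?E"
      by (simp add: shift_act_def)
    ultimately show ?thesis
      by (simp add: Bij_def)
  qed
  have "shift_act k G (\<gamma> \<otimes>\<^bsub>G\<^esub> \<gamma>') = compose ?E (shift_act k G \<gamma>) (shift_act k G \<gamma>')"
    if "\<gamma> \<in> carrier G" "\<gamma>' \<in> carrier G" for \<gamma> \<gamma>'
  proof (rule extensionalityI[where A = ?E])
    show "shift_act k G (\<gamma> \<otimes>\<^bsub>G\<^esub> \<gamma>') \<in> extensional ?E"
      by (simp add: shift_act_def)
  qed (use that assms in \<open>auto simp: compose_def shift_act_mult\<close>)
  with bij have "shift_act k G \<in> hom G (BijGroup ?E)"
    by (auto simp: hom_def BijGroup_def)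
  then show ?thesis
    by (simp add: group_action_def group_hom_def group_hom_axioms_def group_BijGroup is_group)
qed

end

theory Submission
  imports Defs
begin

text \<open>
  A nonempty open set contains a cylinder given by a pattern \<open>y\<close> on a finite set \<open>D\<close>, so one needs
  a colouring \<open>x\<close> such that for every \<open>\<gamma>\<close> there is a \<open>\<sigma> \<in> F\<close> for which the pattern occurs on
  \<open>D \<sigma>\<inverse> \<gamma>\<close>. If \<open>F\<close> is large, it contains \<open>N\<close> elements \<open>\<sigma>\<close> for which the sets \<open>D \<sigma>\<inverse>\<close> are pairwise
  disjoint; the constraint belonging to \<open>\<gamma>\<close> then involves \<open>m = N |D|\<close> coordinates, every coordinate
  occurs in at most \<open>m\<close> constraints, and only a proportion of \<open>(1 - k\<^sup>-\<^sup>|\<^sup>D\<^sup>|)\<^sup>N\<close> of the patterns violate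
  a given one. The Lovasz Local Lemma would apply; its place is taken here by Rosenfeld's counting
  argument, in which every further coordinate multiplies the number of admissible colourings by at
  least \<open>\<beta>\<close>. Tychonoff's theorem passes from finite to infinite sets of coordinates.
\<close>

section \<open>Colourings avoiding local patterns\<close>

locale forbidden_patterns =
  fixes k :: nat and I :: "'i set" and S :: "'i \<Rightarrow> 'a set" and B :: "'i \<Rightarrow> ('a \<Rightarrow> nat) set"
begin

text \<open>Only constraints supported entirely inside \<open>A\<close> are imposed, so that passing
  to fewer coordinates never creates a violation.\<close>

definition avoiding :: "'a set \<Rightarrow> ('a \<Rightarrow> nat) set" where
  "avoiding A = {x \<in> A \<rightarrow>\<^sub>E {..<k}. \<forall>i\<in>I. S i \<subseteq> A \<longrightarrow> restrict x (S i) \<notin> B i}"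

lemma finite_avoiding: "finite A \<Longrightarrow> finite (avoiding A)"
  by (simp add: avoiding_def finite_PiE)

lemma restrict_avoiding:
  assumes "x \<in> avoiding A" "A' \<subseteq> A"
  shows "restrict x A' \<in> avoiding A'"
proof -
  have "restrict (restrict x A') (S i) = restrict x (S i)" if "S i \<subseteq> A'" for i
    using that by (auto simp: restrict_def fun_eq_iff)
  with assms show ?thesis
    by (fastforce simp: avoiding_def PiE_iff)
qed

end

text \<open>Each constraint has \<open>m\<close> coordinates and at most \<open>b\<close> forbidden
  patterns, and each coordinate meets at most \<open>c\<close> constraints. In
  \<open>growth\<close>, \<open>k\<close> counts the colours offered to a new coordinate and
  \<open>c * b / \<beta> ^ (m - 1)\<close> bounds the loss, relative to the number of old
  colourings; at least \<open>\<beta>\<close> remains. The exponent is \<open>m - 1\<close> because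
  the new coordinate is one of the \<open>m\<close>.\<close>

locale sparse_forbidden_patterns = forbidden_patterns k I S B
  for k :: nat and I :: "'i set" and S :: "'i \<Rightarrow> 'a set" and B :: "'i \<Rightarrow> ('a \<Rightarrow> nat) set" +
  fixes m b c :: nat and \<beta> :: real
  assumes card_support: "i \<in> I \<Longrightarrow> card (S i) = m"
    and support_nonempty: "m \<ge> 1"
    and finite_forbidden: "i \<in> I \<Longrightarrow> finite (B i)"
    and card_forbidden: "i \<in> I \<Longrightarrow> card (B i) \<le> b"
    and finite_incident: "finite {i \<in> I. v \<in> S i}"
    and card_incident: "card {i \<in> I. v \<in> S i} \<le> c"
    and growth_pos: "\<beta> > 0"
    and growth: "\<beta> + real c * real b / \<beta> ^ (m - 1) \<le> real k"
begin

lemma finite_support: "i \<in> I \<Longrightarrow> finite (S i)"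
  using card_support[of i] support_nonempty by (intro card_ge_0_finite) simp

text \<open>Of the \<open>k * card (avoiding A)\<close> extensions to \<open>v\<close>, those
  violating a constraint \<open>i\<close> through \<open>v\<close> are determined by a forbidden
  pattern on \<open>S i\<close> and an avoiding colouring of \<open>A - S i\<close>. By induction
  the latter are fewer than the avoiding colourings of \<open>A\<close> by a factor of
  \<open>\<beta> ^ (m - 1)\<close>.\<close>

lemma card_avoiding_insert:
  assumes "finite A" "v \<notin> A"
  shows "\<beta> * card (avoiding A) \<le> card (avoiding (insert v A))"
  using assms
proof (induction "card A" arbitrary: A v rule: less_induct)
  case less
  \<comment> \<open>Coordinates are put back one at a time, each gaining a factor
    \<open>\<beta>\<close>; the induction hypothesis applies because every set being extended is
    strictly smaller than \<open>A\<close>.\<close>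
  have remove: "\<beta> ^ card T * card (avoiding (A - T)) \<le> card (avoiding A)" if "T \<subseteq> A" for T
    using finite_subset[OF that \<open>finite A\<close>] that
  proof (induction T rule: finite_induct)
    case empty
    then show ?case by simp
  next
    case (insert t T)
    let ?A = "A - insert t T"
    have "card ?A < card A"
      using insert.prems \<open>finite A\<close> by (intro psubset_card_mono) auto
    then have "\<beta> * card (avoiding ?A) \<le> card (avoiding (insert t ?A))"
      using \<open>finite A\<close> by (intro less.hyps) auto
    moreover have "insert t ?A = A - T"
      using insert by auto
    ultimately have "\<beta> ^ card T * (\<beta> * card (avoiding ?A)) \<le> \<beta> ^ card T * card (avoiding (A - T))"
      using growth_pos by (intro mult_left_mono) auto
    also have "\<dots> \<le> card (avoiding A)"
      using insert by auto
    finally show ?case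
      using insert.hyps by (simp add: mult_ac)
  qed
  \<comment> \<open>\<open>W\<close> collects all extensions to \<open>v\<close>, \<open>J\<close>
    the constraints that adding \<open>v\<close> brings into play, and \<open>X i\<close> the
    extensions that violate \<open>i\<close>.\<close>
  define W where "W = {x \<in> insert v A \<rightarrow>\<^sub>E {..<k}. restrict x A \<in> avoiding A}"
  define J where "J = {i \<in> I. v \<in> S i \<and> S i \<subseteq> insert v A}"
  define X where "X i = {x \<in> W. restrict x (S i) \<in> B i}" for i
  have finW: "finite W"
    using \<open>finite A\<close> by (simp add: W_def finite_PiE)
  have "bij_betw (\<lambda>(a, x). x(v := a)) ({..<k} \<times> avoiding A) W"
  proof (rule bij_betw_byWitness[where f' = "\<lambda>x. (x v, restrict x A)"])
    have ext: "restrict (x(v := a)) A = x" if "x \<in> avoiding A" for x a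
      using that \<open>v \<notin> A\<close> by (auto simp: avoiding_def fun_eq_iff restrict_def PiE_iff extensional_def)
    show "\<forall>p\<in>{..<k} \<times> avoiding A. (\<lambda>x. (x v, restrict x A)) ((\<lambda>(a, x). x(v := a)) p) = p"
      by (auto simp: ext)
    show "\<forall>x\<in>W. (\<lambda>(a, x). x(v := a)) (x v, restrict x A) = x"
      using \<open>v \<notin> A\<close> by (auto simp: W_def fun_eq_iff restrict_def PiE_iff extensional_def)
    show "(\<lambda>(a, x). x(v := a)) ` ({..<k} \<times> avoiding A) \<subseteq> W"
      by (auto simp: W_def ext) (auto simp: avoiding_def PiE_iff extensional_def split: if_splits)
    show "(\<lambda>x. (x v, restrict x A)) ` W \<subseteq> {..<k} \<times> avoiding A"
      by (auto simp: W_def)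
  qed
  then have cardW: "card W = k * card (avoiding A)"
    by (metis bij_betw_same_card card_cartesian_product card_lessThan)
  have finJ: "finite J"
    by (rule finite_subset[OF _ finite_incident[of v]]) (auto simp: J_def)
  have cardJ: "card J \<le> c"
    by (rule order_trans[OF card_mono[OF finite_incident[of v]] card_incident[of v]])
      (auto simp: J_def)
  have cardX: "card (X i) \<le> b * (card (avoiding A) / \<beta> ^ (m - 1))" if i: "i \<in> J" for i
  proof -
    have iI: "i \<in> I" and S: "v \<in> S i" "S i \<subseteq> insert v A"
      using i by (auto simp: J_def)
    have "card (X i) \<le> card (B i \<times> avoiding (A - S i))"
    proof (rule card_inj_on_le[where f = "\<lambda>x. (restrict x (S i), restrict x (A - S i))"])
      show "inj_on (\<lambda>x. (restrict x (S i), restrict x (A - S i))) (X i)"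
      proof (rule inj_onI)
        fix x z assume x: "x \<in> X i" and z: "z \<in> X i"
          and eq: "(restrict x (S i), restrict x (A - S i)) = (restrict z (S i), restrict z (A - S i))"
        have "x a = z a" if "a \<in> insert v A" for a
        proof (cases "a \<in> S i")
          case True
          then show ?thesis using eq by (metis prod.inject restrict_apply')
        next
          case False
          then have "a \<in> A - S i" using that S by auto
          then show ?thesis using eq by (metis prod.inject restrict_apply')
        qed
        with x z show "x = z"
          by (intro PiE_ext[of x "insert v A" "\<lambda>_. {..<k}"]) (auto simp: X_def W_def)
      qed
      have "restrict x (A - S i) \<in> avoiding (A - S i)" if "x \<in> X i" for x
        using restrict_avoiding[of "restrict x A" A "A - S i"] that
        by (simp add: X_def W_def Int_absorb1)
      then show "(\<lambda>x. (restrict x (S i), restrict x (A - S i))) ` X i \<subseteq> B i \<times> avoiding (A - S i)"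
        by (auto simp: X_def)
      show "finite (B i \<times> avoiding (A - S i))"
        using finite_forbidden[OF iI] finite_avoiding[of "A - S i"] \<open>finite A\<close> by simp
    qed
    also have "\<dots> \<le> b * card (avoiding (A - S i))"
      using card_forbidden[OF iI] by (simp add: card_cartesian_product)
    finally have "real (card (X i)) \<le> real b * real (card (avoiding (A - S i)))"
      by (metis of_nat_le_iff of_nat_mult)
    also have "\<dots> \<le> b * (card (avoiding A) / \<beta> ^ (m - 1))"
    proof (rule mult_left_mono)
      \<comment> \<open>Since \<open>v\<close> is not in \<open>A\<close>, only \<open>m - 1\<close>
        elements of \<open>S i\<close> are actually removed from \<open>A\<close>.\<close>
      have "card (S i - {v}) = m - 1"
        using S card_support[OF iI] finite_support[OF iI] by simp
      moreover have "A - (S i - {v}) = A - S i"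
        using \<open>v \<notin> A\<close> by auto
      moreover have "S i - {v} \<subseteq> A"
        using S by auto
      ultimately have "\<beta> ^ (m - 1) * card (avoiding (A - S i)) \<le> card (avoiding A)"
        using remove[of "S i - {v}"] by simp
      then show "card (avoiding (A - S i)) \<le> card (avoiding A) / \<beta> ^ (m - 1)"
        using growth_pos by (simp add: field_simps)
    qed simp
    finally show ?thesis .
  qed
  \<comment> \<open>A constraint missing \<open>v\<close> is already respected on \<open>A\<close>,
    so only those in \<open>J\<close> can fail.\<close>
  have "W \<subseteq> avoiding (insert v A) \<union> (\<Union>i\<in>J. X i)"
  proof
    fix x assume x: "x \<in> W"
    show "x \<in> avoiding (insert v A) \<union> (\<Union>i\<in>J. X i)"
    proof (rule UnCI)
      assume nX: "x \<notin> (\<Union>i\<in>J. X i)"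
      have "restrict x (S i) \<notin> B i" if i: "i \<in> I" "S i \<subseteq> insert v A" for i
      proof (cases "v \<in> S i")
        case True
        then show ?thesis using nX x i by (auto simp: J_def X_def)
      next
        case False
        then have SA: "S i \<subseteq> A" using i by auto
        then have "restrict (restrict x A) (S i) = restrict x (S i)"
          by (simp add: Int_absorb1)
        with x SA i show ?thesis by (force simp: W_def avoiding_def)
      qed
      then show "x \<in> avoiding (insert v A)"
        using x by (auto simp: W_def avoiding_def)
    qed
  qed
  then have "card W \<le> card (avoiding (insert v A) \<union> (\<Union>i\<in>J. X i))"
    using \<open>finite A\<close> finJ finW by (intro card_mono) (auto simp: finite_avoiding X_def)
  also have "\<dots> \<le> card (avoiding (insert v A)) + (\<Sum>i\<in>J. card (X i))"
    by (rule order_trans[OF card_Un_le add_left_mono[OF card_UN_le[OF finJ]]])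
  finally have "real k * card (avoiding A) \<le> card (avoiding (insert v A)) + (\<Sum>i\<in>J. real (card (X i)))"
    unfolding cardW by (metis of_nat_add of_nat_le_iff of_nat_mult of_nat_sum)
  also have "(\<Sum>i\<in>J. real (card (X i))) \<le> card J * (b * (card (avoiding A) / \<beta> ^ (m - 1)))"
    by (rule sum_bounded_above) (rule cardX)
  also have "\<dots> \<le> c * (b * (card (avoiding A) / \<beta> ^ (m - 1)))"
    using cardJ growth_pos by (intro mult_right_mono) auto
  also have "\<dots> = (real c * real b / \<beta> ^ (m - 1)) * card (avoiding A)"
    by simp
  finally have "(real k - real c * real b / \<beta> ^ (m - 1)) * card (avoiding A) \<le> card (avoiding (insert v A))"
    by (simp add: algebra_simps)
  moreover have "\<beta> * card (avoiding A) \<le> (real k - real c * real b / \<beta> ^ (m - 1)) * card (avoiding A)"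
    using growth by (intro mult_right_mono) auto
  ultimately show ?case by linarith
qed

lemma avoiding_nonempty:
  assumes "finite A"
  shows "avoiding A \<noteq> {}"
proof -
  have "card (avoiding A) > 0"
    using assms
  proof (induction A rule: finite_induct)
    case empty
    \<comment> \<open>An empty support would impose a constraint even on the empty colouring;
      \<open>m \<ge> 1\<close> excludes this.\<close>
    have "S i \<noteq> {}" if "i \<in> I" for i
      using card_support[OF that] support_nonempty by auto
    then have "avoiding {} = {\<lambda>_. undefined}"
      by (auto simp: avoiding_def)
    then show ?case by simp
  next
    case (insert v A)
    then have "0 < \<beta> * card (avoiding A)"
      using growth_pos by simp
    also have "\<dots> \<le> card (avoiding (insert v A))"
      using insert by (intro card_avoiding_insert)
    finally show ?case by simp
  qed
  then show ?thesis by auto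
qed

end

section \<open>Compactness: from finite to arbitrary sets of coordinates\<close>

text \<open>Membership depends on finitely many coordinates; freezing them at the values of a given
  point yields a basic open box around it.\<close>

lemma openin_local_patterns:
  assumes "finite T" "T \<subseteq> C"
  shows "openin (product_topology (\<lambda>_. discrete_topology K) C)
           {x \<in> C \<rightarrow>\<^sub>E K. restrict x T \<in> P}"
  unfolding openin_product_topology_alt
proof (intro conjI ballI)
  fix x assume x: "x \<in> {x \<in> C \<rightarrow>\<^sub>E K. restrict x T \<in> P}"
  let ?U = "\<lambda>a. if a \<in> T then {x a} else K"
  have eq: "restrict z T = restrict x T" if "z \<in> Pi\<^sub>E C ?U" for z
    using that assms(2) by (fastforce simp: restrict_def fun_eq_iff PiE_iff)
  have fin: "finite {a \<in> C. ?U a \<noteq> topspace (discrete_topology K)}"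
    by (rule finite_subset[OF _ assms(1)]) auto
  have mem: "x \<in> Pi\<^sub>E C ?U" and sub: "Pi\<^sub>E C ?U \<subseteq> C \<rightarrow>\<^sub>E K"
    using x by (auto simp: PiE_iff split: if_splits)
  have op: "\<forall>a\<in>C. openin (discrete_topology K) (?U a)"
    using x by auto
  have "Pi\<^sub>E C ?U \<subseteq> {x \<in> C \<rightarrow>\<^sub>E K. restrict x T \<in> P}"
    using sub eq x by auto
  with fin mem op show "\<exists>U. finite {i \<in> C. U i \<noteq> topspace (discrete_topology K)} \<and>
      (\<forall>i\<in>C. openin (discrete_topology K) (U i)) \<and> x \<in> Pi\<^sub>E C U \<and>
      Pi\<^sub>E C U \<subseteq> {x \<in> C \<rightarrow>\<^sub>E K. restrict x T \<in> P}"
    by (intro exI[of _ ?U] conjI)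
qed

lemma closedin_local_patterns:
  assumes "finite T" "T \<subseteq> C"
  shows "closedin (product_topology (\<lambda>_. discrete_topology K) C)
           {x \<in> C \<rightarrow>\<^sub>E K. restrict x T \<in> P}"
proof -
  have "(C \<rightarrow>\<^sub>E K) - {x \<in> C \<rightarrow>\<^sub>E K. restrict x T \<in> P} = {x \<in> C \<rightarrow>\<^sub>E K. restrict x T \<in> - P}"
    by auto
  then show ?thesis
    using openin_local_patterns[OF assms, of K "- P"] by (auto simp: closedin_def)
qed

context sparse_forbidden_patterns
begin

text \<open>Each constraint is a closed condition, and finitely many of them involve finitely many
  coordinates, where \<open>avoiding_nonempty\<close> satisfies them together. The finite
  intersection property then satisfies all of them.\<close>

lemma ex_avoiding:
  assumes "k \<ge> 1" "\<And>i. i \<in> I \<Longrightarrow> S i \<subseteq> C"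
  shows "\<exists>x \<in> C \<rightarrow>\<^sub>E {..<k}. \<forall>i\<in>I. restrict x (S i) \<notin> B i"
\<comment> \<open>The intersection of an empty family is the whole type and would not yield a
  colouring of \<open>C\<close>.\<close>
proof (cases "I = {}")
  case True
  have "(\<lambda>a\<in>C. 0) \<in> C \<rightarrow>\<^sub>E {..<k}"
    using assms(1) by auto
  then show ?thesis using True by blast
next
  case False
  let ?T = "product_topology (\<lambda>_. discrete_topology {..<k}) C"
  define Z where "Z i = {x \<in> C \<rightarrow>\<^sub>E {..<k}. restrict x (S i) \<in> - B i}" for i
  have "compact_space ?T"
    by (simp add: compact_space_product_topology compact_space_discrete_topology)
  moreover have "\<forall>T\<in>Z ` I. closedin ?T T"
    unfolding Z_def using closedin_local_patterns[OF finite_support assms(2)] by blast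
  moreover have "\<Inter>\<F> \<noteq> {}" if "finite \<F>" "\<F> \<subseteq> Z ` I" for \<F>
  proof -
    obtain J where J: "finite J" "J \<subseteq> I" "\<F> = Z ` J"
      using finite_subset_image[OF \<open>finite \<F>\<close> \<open>\<F> \<subseteq> Z ` I\<close>] by auto
    let ?A = "\<Union>i\<in>J. S i"
    have "finite ?A"
      using J finite_support by auto
    then obtain x where x: "x \<in> avoiding ?A"
      using avoiding_nonempty by blast
    \<comment> \<open>The default colour 0 is legal because \<open>k \<ge> 1\<close>.\<close>
    define z where "z = (\<lambda>a\<in>C. if a \<in> ?A then x a else 0)"
    have "z \<in> Z i" if "i \<in> J" for i
    proof -
      have "restrict z (S i) = restrict x (S i)"
        using that J assms(2) by (fastforce simp: z_def restrict_def fun_eq_iff)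
      moreover have "restrict x (S i) \<notin> B i"
        using x that J by (auto simp: avoiding_def)
      moreover have "z \<in> C \<rightarrow>\<^sub>E {..<k}"
        using x assms(1) by (auto simp: z_def avoiding_def)
      ultimately show ?thesis
        by (simp add: Z_def)
    qed
    then show ?thesis using J by auto
  qed
  ultimately have "\<Inter>(Z ` I) \<noteq> {}"
    unfolding compact_space_fip by blast
  then show ?thesis
    using False by (auto simp: Z_def)
qed

end

section \<open>Group translates of a pattern\<close>

lemma openin_shift_space_cylinder:
  assumes "openin (shift_space k G) V" "y \<in> V"
  obtains D where "finite D" "D \<subseteq> carrier G"
    "\<And>x. x \<in> topspace (shift_space k G) \<Longrightarrow> (\<And>d. d \<in> D \<Longrightarrow> x d = y d) \<Longrightarrow> x \<in> V"
proof -
  obtain U where U: "finite {g \<in> carrier G. U g \<noteq> {..<k}}" "y \<in> Pi\<^sub>E (carrier G) U"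
      "Pi\<^sub>E (carrier G) U \<subseteq> V"
    using assms by (fastforce simp: shift_space_def openin_product_topology_alt)
  show thesis
  proof (rule that[OF U(1)])
    fix x assume x: "x \<in> topspace (shift_space k G)"
      and eq: "\<And>d. d \<in> {g \<in> carrier G. U g \<noteq> {..<k}} \<Longrightarrow> x d = y d"
    have "x g \<in> U g" if "g \<in> carrier G" for g
      using that eq[of g] U(2) x by (cases "U g = {..<k}") (auto simp: topspace_shift_space PiE_iff)
    with x U(3) show "x \<in> V"
      by (auto simp: topspace_shift_space PiE_iff subset_iff)
  qed auto
qed

context group
begin

text \<open>Greedy choice: \<open>\<tau>\<close> conflicts with a chosen \<open>\<sigma>\<close>
  only if \<open>d \<otimes> inv \<sigma> = e \<otimes> inv \<tau>\<close>, that is,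
  \<open>\<tau> = \<sigma> \<otimes> inv d \<otimes> e\<close>. So \<open>N\<close> chosen elements
  rule out at most \<open>N * (card D)\<^sup>2\<close> candidates.\<close>

lemma ex_disjoint_translates:
  assumes "finite D" "D \<noteq> {}" "D \<subseteq> carrier G" "finite F" "F \<subseteq> carrier G"
    and "card F \<ge> N * (card D)\<^sup>2"
  shows "\<exists>F'\<subseteq>F. card F' = N \<and> inj_on (\<lambda>(\<sigma>, d). d \<otimes> inv \<sigma>) (F' \<times> D)"
  using assms(6)
proof (induction N)
  case 0
  then show ?case by (intro exI[of _ "{}"]) auto
next
  case (Suc N)
  then obtain F' where F': "F' \<subseteq> F" "card F' = N" "inj_on (\<lambda>(\<sigma>, d). d \<otimes> inv \<sigma>) (F' \<times> D)"
    by auto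
  have finF': "finite F'"
    using F' assms finite_subset by blast
  define X where "X = (\<lambda>(\<sigma>, d, e). \<sigma> \<otimes> inv d \<otimes> e) ` (F' \<times> D \<times> D)"
  have "card X \<le> card (F' \<times> D \<times> D)"
    unfolding X_def using finF' assms by (intro card_image_le) auto
  also have "\<dots> = N * (card D)\<^sup>2"
    using F' by (simp add: card_cartesian_product power2_eq_square)
  also have "\<dots> < Suc N * (card D)\<^sup>2"
    using assms by (simp add: card_gt_0_iff)
  finally have "card X < card F"
    using Suc.prems by linarith
  moreover have "finite X"
    unfolding X_def using finF' assms by auto
  ultimately obtain \<tau> where \<tau>: "\<tau> \<in> F" "\<tau> \<notin> X"
    by (metis card_mono leD subsetI)
  have \<tau>G: "\<tau> \<in> carrier G"
    using \<tau> assms by auto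
  have mem_X: "\<tau> \<in> X"
    if "\<sigma> \<in> F'" "d \<in> D" "e \<in> D" "d \<otimes> inv \<sigma> = e \<otimes> inv \<tau>" for \<sigma> d e
  proof -
    have G: "\<sigma> \<in> carrier G" "d \<in> carrier G" "e \<in> carrier G"
      using that F' assms by auto
    have "inv (d \<otimes> inv \<sigma>) = inv (e \<otimes> inv \<tau>)"
      using that by simp
    then have "\<sigma> \<otimes> inv d = \<tau> \<otimes> inv e"
      using G \<tau>G by (simp add: inv_mult_group)
    then have "\<sigma> \<otimes> inv d \<otimes> e = \<tau>"
      using G \<tau>G by (simp add: m_assoc)
    then show ?thesis
      using that by (force simp: X_def)
  qed
  \<comment> \<open>The case \<open>d = e\<close> shows that \<open>X\<close> contains
    \<open>F'\<close>, as \<open>D\<close> is nonempty.\<close>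
  have "\<tau> \<notin> F'"
    using mem_X \<tau> assms(2) by blast
  moreover have "inj_on (\<lambda>(\<sigma>, d). d \<otimes> inv \<sigma>) (insert \<tau> F' \<times> D)"
  proof (rule inj_onI, clarify)
    fix \<sigma> d \<sigma>' d'
    assume *: "\<sigma> \<in> insert \<tau> F'" "d \<in> D" "\<sigma>' \<in> insert \<tau> F'" "d' \<in> D"
      and eq: "d \<otimes> inv \<sigma> = d' \<otimes> inv \<sigma>'"
    consider "\<sigma> = \<tau>" "\<sigma>' = \<tau>" | "\<sigma> \<in> F'" "\<sigma>' \<in> F'" | "\<sigma> \<in> F'" "\<sigma>' = \<tau>" | "\<sigma> = \<tau>" "\<sigma>' \<in> F'"
      using * by auto
    then show "\<sigma> = \<sigma>' \<and> d = d'"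
    proof cases
      case 1
      then show ?thesis
        using eq * assms \<tau>G by (metis inv_closed right_cancel subsetD)
    next
      case 2
      then show ?thesis
        using inj_onD[OF F'(3), of "(\<sigma>, d)" "(\<sigma>', d')"] eq * by auto
    next
      case 3
      then show ?thesis using mem_X[of \<sigma> d d'] eq * \<tau> by auto
    next
      case 4
      then show ?thesis using mem_X[of \<sigma>' d' d] eq * \<tau> by auto
    qed
  qed
  ultimately show ?case
    using F' finF' \<tau> by (intro exI[of _ "insert \<tau> F'"]) auto
qed

end

section \<open>Numerical parameters for the counting argument\<close>

text \<open>With \<open>m = N * d\<close> and \<open>\<beta> = k * (1 - 1 / (2 * m))\<close>, the
  power \<open>\<beta> ^ (m - 1)\<close> is at least half of \<open>k ^ (m - 1)\<close>. The loss is
  then at most \<open>2 * k * m * r ^ N\<close>, while the slack is \<open>k / (2 * m)\<close>. So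
  \<open>4 * m\<^sup>2 * r ^ N < 1\<close> suffices, which holds for large \<open>N\<close>.\<close>

lemma ex_growth_rate:
  fixes k d :: nat
  assumes "k \<ge> 1" "d \<ge> 1"
  obtains N :: nat and \<beta> :: real
  where "N \<ge> 1" "\<beta> > 0"
    "\<beta> + real (N * d) * real ((k ^ d - 1) ^ N) / \<beta> ^ (N * d - 1) \<le> real k"
proof -
  \<comment> \<open>The proportion of patterns on \<open>d\<close> coordinates that differ from a
    prescribed one.\<close>
  define r where "r = 1 - 1 / real k ^ d"
  have r: "0 \<le> r" "r < 1"
    using assms by (auto simp: r_def field_simps)
  \<comment> \<open>The square root lets a limit with a linear factor, once squared, control
    \<open>N\<^sup>2 * r ^ N\<close>.\<close>
  have "(\<lambda>N. real N * sqrt r ^ N) \<longlonglongrightarrow> 0"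
    using r by (intro powser_times_n_limit_0) (auto simp: real_sqrt_lt_1_iff)
  then have "(\<lambda>N. 4 * (real d)\<^sup>2 * (real N * sqrt r ^ N)\<^sup>2) \<longlonglongrightarrow> 4 * (real d)\<^sup>2 * 0\<^sup>2"
    by (intro tendsto_intros)
  then have "\<forall>\<^sub>F N in sequentially. 4 * (real d)\<^sup>2 * (real N * sqrt r ^ N)\<^sup>2 < 1"
    by (intro order_tendstoD(2)) auto
  then have "\<forall>\<^sub>F N in sequentially. 4 * (real d)\<^sup>2 * (real N * sqrt r ^ N)\<^sup>2 < 1 \<and> N \<ge> 1"
    using eventually_ge_at_top eventually_conj by blast
  then obtain N where N: "4 * (real d)\<^sup>2 * (real N * sqrt r ^ N)\<^sup>2 < 1" "N \<ge> 1"
    using eventually_happens by fastforce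
  define m where "m = N * d"
  have m: "m \<ge> 1"
    using N assms by (simp add: m_def)
  have "(sqrt r ^ N)\<^sup>2 = r ^ N"
    using r by (metis power_commutes power_mult mult.commute real_sqrt_pow2)
  then have small: "4 * (real m)\<^sup>2 * r ^ N < 1"
    using N by (simp add: m_def power_mult_distrib mult_ac)
  define \<delta> where "\<delta> = 1 / (2 * real m)"
  define \<beta> where "\<beta> = real k * (1 - \<delta>)"
  have \<delta>: "0 < \<delta>" "\<delta> \<le> 1 / 2"
    using m by (auto simp: \<delta>_def field_simps)
  have "\<beta> > 0"
    using \<delta> assms by (simp add: \<beta>_def)
  \<comment> \<open>Bernoulli: \<open>m - 1\<close> factors, each short of 1 by
    \<open>1 / (2 * m)\<close>, lose less than half in total.\<close>
  have "1 / 2 \<le> 1 + real (m - 1) * (- \<delta>)"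
    using m by (simp add: \<delta>_def field_simps of_nat_diff)
  also have "\<dots> \<le> (1 + (- \<delta>)) ^ (m - 1)"
    using \<delta> by (intro Bernoulli_inequality) auto
  finally have half: "1 / 2 \<le> (1 - \<delta>) ^ (m - 1)"
    by simp
  have "real (k ^ d - 1) = real k ^ d * r"
    using assms by (simp add: r_def of_nat_diff right_diff_distrib)
  then have "real ((k ^ d - 1) ^ N) = real k ^ m * r ^ N"
    by (simp add: m_def power_mult_distrib mult.commute flip: power_mult)
  also have "real k ^ m = real k * real k ^ (m - 1)"
    using m by (simp flip: power_Suc)
  finally have b: "real ((k ^ d - 1) ^ N) = real k * real k ^ (m - 1) * r ^ N" .
  have "real m * real ((k ^ d - 1) ^ N) / \<beta> ^ (m - 1) = real k * (m * r ^ N) / (1 - \<delta>) ^ (m - 1)"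
    unfolding b using assms \<delta> by (simp add: \<beta>_def power_mult_distrib)
  also have "\<dots> \<le> real k * (m * r ^ N) / (1 / 2)"
    using half r by (intro divide_left_mono) auto
  also have "\<dots> \<le> real k * \<delta>"
  proof -
    have "2 * (m * r ^ N) \<le> \<delta>"
      using small m by (simp add: \<delta>_def field_simps power2_eq_square)
    then have "real k * (2 * (m * r ^ N)) \<le> real k * \<delta>"
      by (intro mult_left_mono) auto
    then show ?thesis by simp
  qed
  finally have "\<beta> + real m * real ((k ^ d - 1) ^ N) / \<beta> ^ (m - 1) \<le> real k"
    by (simp add: \<beta>_def algebra_simps)
  with \<open>\<beta> > 0\<close> N that show thesis
    by (simp add: m_def)
qed

section \<open>Construction of the trapped point\<close>

text \<open>The constraint indexed by \<open>\<gamma>\<close> forbids that every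
  \<open>\<sigma>\<close> in \<open>F'\<close> misses the pattern \<open>y\<close>. A colouring
  avoiding it has some \<open>\<sigma>\<close> moving \<open>\<gamma> \<cdot> x\<close> into
  \<open>V\<close> by \<open>inv \<sigma>\<close>. The threshold is
  \<open>n = N * (card D)\<^sup>2\<close>.\<close>

lemma (in group) ex_trapped_point:
  fixes k :: nat
  assumes "k \<ge> 1" and "openin (shift_space k G) V" and "V \<noteq> {}"
  shows "\<exists>n. \<forall>F. F \<subseteq> carrier G \<and> finite F \<and> card F \<ge> n \<longrightarrow>
           (\<exists>x \<in> topspace (shift_space k G).
              traps G (shift_act k G) (translates (shift_act k G) F V) x)"
proof -
  obtain y where "y \<in> V"
    using assms by auto
  then have y: "y \<in> carrier G \<rightarrow>\<^sub>E {..<k}"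
    using openin_subset[OF assms(2)] by (auto simp: topspace_shift_space)
  obtain D0 where D0: "finite D0" "D0 \<subseteq> carrier G"
    "\<And>x. x \<in> topspace (shift_space k G) \<Longrightarrow> (\<And>d. d \<in> D0 \<Longrightarrow> x d = y d) \<Longrightarrow> x \<in> V"
    using openin_shift_space_cylinder[OF assms(2) \<open>y \<in> V\<close>] by blast
  \<comment> \<open>Adding \<open>\<one>\<close> makes the set nonempty, even if \<open>V\<close> is
    the whole space; the cylinder only shrinks.\<close>
  define D where "D = insert \<one> D0"
  have D: "finite D" "D \<noteq> {}" "D \<subseteq> carrier G"
    "\<And>x. x \<in> topspace (shift_space k G) \<Longrightarrow> (\<And>d. d \<in> D \<Longrightarrow> x d = y d) \<Longrightarrow> x \<in> V"
    using D0 by (auto simp: D_def)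
  have "card D \<ge> 1"
    using D(1-3) by (simp add: Suc_le_eq card_gt_0_iff)
  then obtain N \<beta> where N: "N \<ge> 1" "\<beta> > 0"
    "\<beta> + real (N * card D) * real ((k ^ card D - 1) ^ N) / \<beta> ^ (N * card D - 1) \<le> real k"
    using ex_growth_rate[OF assms(1)] by metis
  have "\<exists>x \<in> topspace (shift_space k G). traps G (shift_act k G) (translates (shift_act k G) F V) x"
    if F: "F \<subseteq> carrier G" "finite F" "card F \<ge> N * (card D)\<^sup>2" for F
  proof -
    obtain F' where F': "F' \<subseteq> F" "card F' = N" "inj_on (\<lambda>(\<sigma>, d). d \<otimes> inv \<sigma>) (F' \<times> D)"
      using ex_disjoint_translates[OF D(1-3) F(2,1,3)] by blast
    have finF': "finite F'" and F'G: "F' \<subseteq> carrier G"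
      using F' F finite_subset by auto
    \<comment> \<open>\<open>S \<gamma>\<close> lists the coordinates of \<open>x\<close> that the
      points \<open>inv \<sigma> \<otimes> \<gamma>\<close> applied to \<open>x\<close> show on
      \<open>D\<close>.\<close>
    define S where "S \<gamma> = (\<lambda>(\<sigma>, d). d \<otimes> inv \<sigma> \<otimes> \<gamma>) ` (F' \<times> D)" for \<gamma>
    define B where "B \<gamma> = {z \<in> S \<gamma> \<rightarrow>\<^sub>E {..<k}. \<forall>\<sigma>\<in>F'. \<exists>d\<in>D. z (d \<otimes> inv \<sigma> \<otimes> \<gamma>) \<noteq> y d}" for \<gamma>
    have finS: "finite (S \<gamma>)" for \<gamma>
      using finF' D(1-3) by (simp add: S_def)
    have SG: "S \<gamma> \<subseteq> carrier G" if "\<gamma> \<in> carrier G" for \<gamma>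
      using that F'G D(1-3) by (auto simp: S_def intro!: m_closed inv_closed)
    interpret sparse_forbidden_patterns k "carrier G" S B
      "N * card D" "(k ^ card D - 1) ^ N" "N * card D" \<beta>
    proof
      fix \<gamma> assume \<gamma>: "\<gamma> \<in> carrier G"
      have "inj_on (\<lambda>(\<sigma>, d). d \<otimes> inv \<sigma> \<otimes> \<gamma>) (F' \<times> D)"
      proof (rule inj_onI, clarify)
        fix \<sigma> d \<sigma>' d'
        assume *: "\<sigma> \<in> F'" "d \<in> D" "\<sigma>' \<in> F'" "d' \<in> D"
          and "d \<otimes> inv \<sigma> \<otimes> \<gamma> = d' \<otimes> inv \<sigma>' \<otimes> \<gamma>"
        moreover have "\<sigma> \<in> carrier G" "d \<in> carrier G" "\<sigma>' \<in> carrier G" "d' \<in> carrier G"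
          using * F'G D(3) by auto
        ultimately have "d \<otimes> inv \<sigma> = d' \<otimes> inv \<sigma>'"
          using \<gamma> by simp
        with * show "\<sigma> = \<sigma>' \<and> d = d'"
          using inj_onD[OF F'(3), of "(\<sigma>, d)" "(\<sigma>', d')"] by auto
      qed
      then show "card (S \<gamma>) = N * card D"
        using F' by (simp add: S_def card_image card_cartesian_product)
      show "finite (B \<gamma>)"
        using finS by (simp add: B_def finite_PiE)
      \<comment> \<open>A forbidden pattern splits into \<open>N\<close> blocks, one per
        \<open>\<sigma>\<close>, each a colouring of \<open>D\<close> other than
        \<open>y\<close>.\<close>
      let ?P = "F' \<rightarrow>\<^sub>E ((D \<rightarrow>\<^sub>E {..<k}) - {restrict y D})"
      have "card (B \<gamma>) \<le> card ?P"
      proof (rule card_inj_on_le[where f = "\<lambda>z. \<lambda>\<sigma>\<in>F'. \<lambda>d\<in>D. z (d \<otimes> inv \<sigma> \<otimes> \<gamma>)"])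
        show "inj_on (\<lambda>z. \<lambda>\<sigma>\<in>F'. \<lambda>d\<in>D. z (d \<otimes> inv \<sigma> \<otimes> \<gamma>)) (B \<gamma>)"
        proof (rule inj_onI)
          fix z w assume zw: "z \<in> B \<gamma>" "w \<in> B \<gamma>"
            and eq: "(\<lambda>\<sigma>\<in>F'. \<lambda>d\<in>D. z (d \<otimes> inv \<sigma> \<otimes> \<gamma>)) = (\<lambda>\<sigma>\<in>F'. \<lambda>d\<in>D. w (d \<otimes> inv \<sigma> \<otimes> \<gamma>))"
          have "z (d \<otimes> inv \<sigma> \<otimes> \<gamma>) = w (d \<otimes> inv \<sigma> \<otimes> \<gamma>)" if "\<sigma> \<in> F'" "d \<in> D" for \<sigma> d
            using fun_cong[OF fun_cong[OF eq, of \<sigma>], of d] that by simp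
          then have "z a = w a" if "a \<in> S \<gamma>" for a
            using that by (auto simp: S_def)
          with zw show "z = w"
            by (intro PiE_ext[of z "S \<gamma>" "\<lambda>_. {..<k}"]) (auto simp: B_def)
        qed
        show "(\<lambda>z. \<lambda>\<sigma>\<in>F'. \<lambda>d\<in>D. z (d \<otimes> inv \<sigma> \<otimes> \<gamma>)) ` B \<gamma> \<subseteq> ?P"
        proof (rule image_subsetI, rule restrict_PiE_iff[THEN iffD2], rule ballI)
          fix z \<sigma> assume z: "z \<in> B \<gamma>" and \<sigma>: "\<sigma> \<in> F'"
          have "(\<lambda>d\<in>D. z (d \<otimes> inv \<sigma> \<otimes> \<gamma>)) \<noteq> restrict y D"
            using z \<sigma> by (auto simp: B_def dest!: bspec) (metis restrict_apply')
          moreover have "z (d \<otimes> inv \<sigma> \<otimes> \<gamma>) < k" if "d \<in> D" for d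
          proof -
            have "d \<otimes> inv \<sigma> \<otimes> \<gamma> \<in> S \<gamma>"
              using that \<sigma> by (force simp: S_def)
            then show ?thesis using z by (auto simp: B_def)
          qed
          ultimately show "(\<lambda>d\<in>D. z (d \<otimes> inv \<sigma> \<otimes> \<gamma>)) \<in> (D \<rightarrow>\<^sub>E {..<k}) - {restrict y D}"
            by auto
        qed
        show "finite ?P"
          using finF' D(1-3) by (simp add: finite_PiE)
      qed
      also have "card ?P = (k ^ card D - 1) ^ N"
      proof -
        have "restrict y D \<in> D \<rightarrow>\<^sub>E {..<k}"
          using y D(1-3) by auto
        then show ?thesis
          using finF' D(1-3) F' by (simp add: card_PiE finite_PiE)
      qed
      finally show "card (B \<gamma>) \<le> (k ^ card D - 1) ^ N" .
    next
      fix v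
      \<comment> \<open>Solving \<open>v = d \<otimes> inv \<sigma> \<otimes> \<gamma>\<close> for
        \<open>\<gamma>\<close> leaves one solution per pair, so the bound on incident constraints
        equals the support size.\<close>
      let ?f = "\<lambda>(\<sigma>, d). \<sigma> \<otimes> inv d \<otimes> v"
      have sub: "{\<gamma> \<in> carrier G. v \<in> S \<gamma>} \<subseteq> ?f ` (F' \<times> D)"
      proof clarify
        fix \<gamma> assume \<gamma>: "\<gamma> \<in> carrier G" "v \<in> S \<gamma>"
        then obtain \<sigma> d where *: "\<sigma> \<in> F'" "d \<in> D" "v = d \<otimes> inv \<sigma> \<otimes> \<gamma>"
          by (auto simp: S_def)
        have G: "\<sigma> \<in> carrier G" "d \<in> carrier G"
          using * F'G D(1-3) by auto
        have "inv d \<otimes> (d \<otimes> (inv \<sigma> \<otimes> \<gamma>)) = inv \<sigma> \<otimes> \<gamma>" "\<sigma> \<otimes> (inv \<sigma> \<otimes> \<gamma>) = \<gamma>"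
          using G \<gamma>(1) by (simp_all flip: m_assoc)
        then have "\<gamma> = ?f (\<sigma>, d)"
          using G \<gamma>(1) by (simp add: *(3) m_assoc)
        then show "\<gamma> \<in> ?f ` (F' \<times> D)"
          using * by blast
      qed
      have fin: "finite (?f ` (F' \<times> D))"
        using finF' D(1-3) by simp
      show "finite {\<gamma> \<in> carrier G. v \<in> S \<gamma>}"
        using finite_subset[OF sub fin] .
      have "card {\<gamma> \<in> carrier G. v \<in> S \<gamma>} \<le> card (?f ` (F' \<times> D))"
        using card_mono[OF fin sub] .
      also have "\<dots> \<le> card (F' \<times> D)"
        using finF' D(1-3) by (intro card_image_le) simp
      finally show "card {\<gamma> \<in> carrier G. v \<in> S \<gamma>} \<le> N * card D"
        using F' by (simp add: card_cartesian_product)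
    next
      show "N * card D \<ge> 1"
        using N \<open>card D \<ge> 1\<close> by simp
    qed (use N in auto)
    obtain x where x: "x \<in> carrier G \<rightarrow>\<^sub>E {..<k}"
      and nB: "\<And>\<gamma>. \<gamma> \<in> carrier G \<Longrightarrow> restrict x (S \<gamma>) \<notin> B \<gamma>"
      using ex_avoiding[OF assms(1) SG] by blast
    have xT: "x \<in> topspace (shift_space k G)"
      using x by (simp add: topspace_shift_space)
    have "shift_act k G \<gamma> x \<in> translates (shift_act k G) F V" if \<gamma>: "\<gamma> \<in> carrier G" for \<gamma>
    proof -
      have "restrict x (S \<gamma>) \<in> S \<gamma> \<rightarrow>\<^sub>E {..<k}"
        using x SG[OF \<gamma>] by auto
      then obtain \<sigma> where \<sigma>: "\<sigma> \<in> F'"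
        and eq: "\<And>d. d \<in> D \<Longrightarrow> restrict x (S \<gamma>) (d \<otimes> inv \<sigma> \<otimes> \<gamma>) = y d"
        using nB[OF \<gamma>] by (auto simp: B_def)
      have \<sigma>G: "\<sigma> \<in> carrier G"
        using \<sigma> F'G by auto
      \<comment> \<open>Its value at \<open>d\<close> is
        \<open>x (d \<otimes> inv \<sigma> \<otimes> \<gamma>)\<close>, hence it agrees with
        \<open>y\<close> on \<open>D\<close>; acting by \<open>\<sigma>\<close> returns the orbit
        point of \<open>\<gamma>\<close>.\<close>
      let ?v = "shift_act k G (inv \<sigma> \<otimes> \<gamma>) x"
      have vT: "?v \<in> topspace (shift_space k G)"
        using \<sigma>G \<gamma> xT by (intro shift_act_closed is_group) auto
      have "?v d = y d" if d: "d \<in> D" for d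
      proof -
        have "d \<otimes> inv \<sigma> \<otimes> \<gamma> \<in> S \<gamma>"
          using d \<sigma> by (force simp: S_def)
        then have "x (d \<otimes> inv \<sigma> \<otimes> \<gamma>) = y d"
          using eq[OF d] by simp
        moreover have "d \<in> carrier G"
          using d D(1-3) by auto
        ultimately show ?thesis
          using xT \<sigma>G \<gamma> by (simp add: shift_act_def m_assoc)
      qed
      then have "?v \<in> V"
        using D(4)[OF vT] by blast
      moreover have "shift_act k G \<sigma> ?v = shift_act k G (\<sigma> \<otimes> (inv \<sigma> \<otimes> \<gamma>)) x"
        using \<sigma>G \<gamma> xT is_group by (simp add: shift_act_mult)
      then have "shift_act k G \<gamma> x = shift_act k G \<sigma> ?v"
        using \<sigma>G \<gamma> by (simp flip: m_assoc)
      ultimately show ?thesis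
        using \<sigma> F' unfolding translates_def by blast
    qed
    then show ?thesis
      using xT by (auto simp: traps_def orbit_def)
  qed
  then show ?thesis by blast
qed

theorem theorem1p2:
  fixes G :: "('a, 'b) monoid_scheme" and k :: nat and V :: "('a \<Rightarrow> nat) set"
  assumes "group G" and "infinite (carrier G)"
    and "k \<ge> 1"
    and "openin (shift_space k G) V" and "V \<noteq> {}"
  shows "\<exists>n::nat. \<forall>F. F \<subseteq> carrier G \<and> finite F \<and> card F \<ge> n \<longrightarrow>
           (\<exists>x \<in> topspace (shift_space k G).
              traps G (shift_act k G) (translates (shift_act k G) F V) x)"
  using group.ex_trapped_point[OF assms(1) assms(3-5)] .

end
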